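(* Let $r\ge1$ and $n>r$ be integers, let $E_j=[\alpha_j,\beta_j]\subseteq[0,2\pi)$, $j=1,\dots,r$, be pairwise disjoint intervals of equal length $\Delta=\beta_j-\alpha_j>0$. Consider the multi-index $\vec n=(n-r,1,\dots,1)\in\mathbb N^{r+1}$ and the weights on the unit circle $\omega^{(1)}(e^{i\theta})=1$, $\omega^{(j+1)}(e^{i\theta})=\mathbf 1_{E_j}(\theta)$, $j=1,\dots,r$; assume that the type I and type II objects exist and are unique for every nonzero multi-index on the natural path from $\vec 0$ to $\vec n$. Let $\mathcal K$ be the Christoffel–Darboux kernel of this multiple orthogonal system and $\mathcal K_0(z,\xi)=\sum_{j=0}^{n-1}(z\overline\xi)^j$ the Christoffel–Darboux kernel of the orthogonal polynomials for $\omega^{(1)}=1$. Then for $z\in\mathbb C$, $\xi\in\mathbb T$, $$\mathcal K(z,\xi)-\mathcal K_0(z,\xi)=\sum_{p=1}^r\left(\mathbf 1_{E_p}(\arg\xi)-\sum_{j=0}^{n-1}\xi^{-j}a_jx_p^j\right)\left(\frac{x_p^{-(n-r)}}{\prod_{m=1,\,m\ne p}^r(x_p-x_m)}\sum_{k=1}^r(-1)^{r-k}e_{r-k}(\hat x_p)\frac{z^{l_k}}{a_{l_k}}\right).$$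
   Context: For weights $\omega^{(1)},\dots,\omega^{(r+1)}$ on $\mathbb T=\{|z|=1\}$ and a multi-index $\vec m=(m_1,\dots,m_{r+1})$ with $|\vec m|=\sum_jm_j$: the type II polynomial $\Phi_{\vec m}$ is a monic polynomial of degree $|\vec m|$ with $\int_{\mathbb T}\Phi_{\vec m}(z)\overline{z^k}\omega^{(j)}(z)\frac{|dz|}{2\pi}=0$ for $k=0,\dots,m_j-1$ and all $j$. The type I object is a nonzero vector of polynomials $(\Lambda_1,\dots,\Lambda_{r+1})$ with $\deg\Lambda_j\le m_j-1$ such that the linear form $\Psi_{\vec m}(z)=\sum_j\Lambda_j(z)\omega^{(j)}(z)$ satisfies $\int_{\mathbb T}\Psi_{\vec m}(z)\overline{z^k}\frac{|dz|}{2\pi}=0$ for $k=0,\dots,|\vec m|-2$ and $=1$ for $k=|\vec m|-1$. Kernel: let $\vec n_0=\vec0,\vec n_1,\dots,\vec n_n=\vec n$ be the natural path, i.e. $|\vec n_j|=j$ and the path first increases the first component by unit steps to its final value, then the second, and so on. Then $\mathcal K(z,\xi)=\sum_{j=0}^{n-1}\Phi_{\vec n_j}(z)\overline{\Psi_{\vec n_{j+1}}(\xi)}$. Notation: $\arg\xi\in[0,2\pi)$; $\theta_j=\frac{\alpha_j+\beta_j}2$, $x_j=e^{i\theta_j}$; $a_\ell=\frac1{\ell\pi}\sin\left(\frac{\ell\Delta}2\right)$ for $\ell\ne0$ and $a_0=\frac{\Delta}{2\pi}$; $l_k=n-r+k-1$; $e_s(\hat x_p)$ is the elementary symmetric polynomial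 of degree $s$ in the $r-1$ variables $x_1,\dots,x_{p-1},x_{p+1},\dots,x_r$ (with $e_0=1$). *)

theory Defs
  imports "HOL-Analysis.Analysis" "HOL-Computational_Algebra.Polynomial"
begin

text \<open>
  Multi-indices, weight systems and polynomial vectors have components numbered \<open>1, \<dots>, s\<close>;
  values at other indices are irrelevant.
\<close>

definition mi_size :: "nat \<Rightarrow> (nat \<Rightarrow> nat) \<Rightarrow> nat" where
  "mi_size s m = (\<Sum>i=1..s. m i)"

text \<open>The integral of \<open>f\<close> over the unit circle against \<open>|dz| / (2 \<pi>)\<close>.\<close>

definition circle_integral :: "(complex \<Rightarrow> complex) \<Rightarrow> complex" where
  "circle_integral f =
     (LINT \<theta>:{0..<2 * pi}|lborel. f (cis \<theta>)) / complex_of_real (2 * pi)"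

definition is_type_II ::
  "nat \<Rightarrow> (nat \<Rightarrow> complex \<Rightarrow> real) \<Rightarrow> (nat \<Rightarrow> nat) \<Rightarrow> complex poly \<Rightarrow> bool" where
  "is_type_II s \<omega> m P \<longleftrightarrow>
     degree P = mi_size s m \<and> lead_coeff P = 1 \<and>
     (\<forall>j\<in>{1..s}. \<forall>k<m j.
        circle_integral (\<lambda>z. poly P z * cnj (z ^ k) * complex_of_real (\<omega> j z)) = 0)"

definition linear_form ::
  "nat \<Rightarrow> (nat \<Rightarrow> complex \<Rightarrow> real) \<Rightarrow> (nat \<Rightarrow> complex poly) \<Rightarrow> complex \<Rightarrow> complex" where
  "linear_form s \<omega> L z = (\<Sum>j=1..s. poly (L j) z * complex_of_real (\<omega> j z))"

text \<open>
  The condition \<open>deg L\<^sub>j \<le> m\<^sub>j - 1\<close> forces \<open>L\<^sub>j = 0\<close> when \<open>m\<^sub>j = 0\<close>. Components outside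
  \<open>{1..s}\<close> are set to \<open>0\<close>, so that uniqueness of \<open>L\<close> as a function is uniqueness of the
  vector \<open>(L\<^sub>1, \<dots>, L\<^sub>s)\<close>. The notion is meant for nonzero multi-indices only.
\<close>

definition is_type_I ::
  "nat \<Rightarrow> (nat \<Rightarrow> complex \<Rightarrow> real) \<Rightarrow> (nat \<Rightarrow> nat) \<Rightarrow> (nat \<Rightarrow> complex poly) \<Rightarrow> bool" where
  "is_type_I s \<omega> m L \<longleftrightarrow>
     (\<exists>j\<in>{1..s}. L j \<noteq> 0) \<and>
     (\<forall>j. j \<notin> {1..s} \<longrightarrow> L j = 0) \<and>
     (\<forall>j\<in>{1..s}. L j = 0 \<or> degree (L j) < m j) \<and>
     (\<forall>k. k + 1 < mi_size s m \<longrightarrow>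
        circle_integral (\<lambda>z. linear_form s \<omega> L z * cnj (z ^ k)) = 0) \<and>
     circle_integral (\<lambda>z. linear_form s \<omega> L z * cnj (z ^ (mi_size s m - 1))) = 1"

definition type_II ::
  "nat \<Rightarrow> (nat \<Rightarrow> complex \<Rightarrow> real) \<Rightarrow> (nat \<Rightarrow> nat) \<Rightarrow> complex poly" where
  "type_II s \<omega> m = (THE P. is_type_II s \<omega> m P)"

definition type_I ::
  "nat \<Rightarrow> (nat \<Rightarrow> complex \<Rightarrow> real) \<Rightarrow> (nat \<Rightarrow> nat) \<Rightarrow> nat \<Rightarrow> complex poly" where
  "type_I s \<omega> m = (THE L. is_type_I s \<omega> m L)"

text \<open>
  The \<open>j\<close>-th point of the natural path from \<open>0\<close> to \<open>m\<close>: component \<open>i\<close> starts growing once the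
  components \<open>1, \<dots>, i - 1\<close> have reached their final values, and stops at \<open>m i\<close>. The subtraction
  is the truncated one.
\<close>

definition natural_path :: "(nat \<Rightarrow> nat) \<Rightarrow> nat \<Rightarrow> nat \<Rightarrow> nat" where
  "natural_path m j i = min (m i) (j - (\<Sum>l=1..<i. m l))"

definition CD_kernel ::
  "nat \<Rightarrow> (nat \<Rightarrow> complex \<Rightarrow> real) \<Rightarrow> (nat \<Rightarrow> nat) \<Rightarrow> complex \<Rightarrow> complex \<Rightarrow> complex" where
  "CD_kernel s \<omega> m z \<xi> =
     (\<Sum>j<mi_size s m. poly (type_II s \<omega> (natural_path m j)) z *
        cnj (linear_form s \<omega> (type_I s \<omega> (natural_path m (j + 1))) \<xi>))"

definition elem_sym :: "nat \<Rightarrow> 'a set \<Rightarrow> ('a \<Rightarrow> 'b::comm_ring_1) \<Rightarrow> 'b" where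
  "elem_sym s A x = (\<Sum>S | S \<subseteq> A \<and> card S = s. \<Prod>i\<in>S. x i)"

end

theory Submission
  imports Defs
begin

text \<open>
  The systems \<open>\<Phi>\<^sub>j\<close> and \<open>\<Psi>\<^sub>j\<^sub>+\<^sub>1\<close> along the path are biorthogonal, so every polynomial \<open>P\<close> of
  degree less than \<open>n\<close> equals \<open>\<Sum>j<n. \<langle>P, \<Psi>\<^sub>j\<^sub>+\<^sub>1\<rangle> \<Phi>\<^sub>j\<close>. The pairing \<open>\<langle>P, \<Psi>\<^sub>j\<^sub>+\<^sub>1\<rangle>\<close> depends only on the
  first \<open>n - r\<close> coefficients of \<open>P\<close> and on its integrals over the arcs. The polynomials \<open>G\<^sub>p\<close> in
  the second factor of the claim are dual to these integrals and have vanishing first \<open>n - r\<close>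
  coefficients. Expanding \<open>G\<^sub>p\<close> and \<open>z\<^sup>l - (\<Sum>p. a\<^sub>l x\<^sub>p\<^sup>l G\<^sub>p)\<close> yields the coefficients of
  \<open>\<one>\<^sub>E\<^sub>p\<close> and of \<open>\<xi>\<^sup>-\<^sup>l\<close> in the kernel.
\<close>

section \<open>The sesquilinear form of a weight on the circle\<close>

definition integrable_weight :: "(complex \<Rightarrow> real) \<Rightarrow> bool" where
  "integrable_weight w \<longleftrightarrow> set_integrable lborel {0..<2 * pi} (\<lambda>\<theta>. w (cis \<theta>))"

definition weight_form :: "(complex \<Rightarrow> real) \<Rightarrow> complex poly \<Rightarrow> complex poly \<Rightarrow> complex" where
  "weight_form w P Q = circle_integral (\<lambda>z. poly P z * cnj (poly Q z) * complex_of_real (w z))"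

lemma circle_integral_cnj: "circle_integral (\<lambda>z. cnj (f z)) = cnj (circle_integral f)"
proof -
  have "(LINT \<theta>:{0..<2*pi}|lborel. cnj (f (cis \<theta>))) = cnj (LINT \<theta>:{0..<2*pi}|lborel. f (cis \<theta>))"
    by (simp add: set_lebesgue_integral_def flip: Bochner_Integration.integral_cnj)
  then show ?thesis
    by (simp add: circle_integral_def)
qed

text \<open>A continuous function is bounded on the compact circle, so the product is dominated by a
  constant multiple of the weight. Additivity of \<open>weight_form\<close> rests on this, since the
  integral is split over sums only for integrable summands.\<close>

lemma set_integrable_weight_mult:
  assumes w: "integrable_weight w" and f: "continuous_on (sphere 0 1) f"
  shows "set_integrable lborel {0..<2*pi} (\<lambda>\<theta>. f (cis \<theta>) * complex_of_real (w (cis \<theta>)))"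
proof -
  have "bounded (f ` sphere 0 1)"
    by (intro compact_imp_bounded compact_continuous_image f) auto
  then obtain B where B: "\<forall>z\<in>sphere 0 1. norm (f z) \<le> B"
    unfolding bounded_iff by auto
  have "continuous_on UNIV (f \<circ> cis)"
    by (intro continuous_on_compose continuous_intros continuous_on_subset [OF f]) auto
  then have [measurable]: "(\<lambda>\<theta>. f (cis \<theta>)) \<in> borel_measurable borel"
    by (simp add: o_def borel_measurable_continuous_onI)
  have int: "integrable lborel (\<lambda>\<theta>. indicator {0..<2*pi} \<theta> *\<^sub>R w (cis \<theta>))"
    using w by (simp add: integrable_weight_def set_integrable_def)
  note [measurable] = borel_measurable_integrable [OF int]
  have "integrable lborel
      (\<lambda>\<theta>. f (cis \<theta>) * complex_of_real (indicator {0..<2*pi} \<theta> *\<^sub>R w (cis \<theta>)))"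
  proof (rule Bochner_Integration.integrable_bound)
    show "integrable lborel (\<lambda>\<theta>. B * (indicator {0..<2*pi} \<theta> *\<^sub>R w (cis \<theta>)))"
      using int by (rule integrable_mult_right)
    show "AE \<theta> in lborel. norm (f (cis \<theta>) * complex_of_real (indicator {0..<2*pi} \<theta> *\<^sub>R w (cis \<theta>)))
        \<le> norm (B * (indicator {0..<2*pi} \<theta> *\<^sub>R w (cis \<theta>)))"
    proof (intro AE_I2)
      fix \<theta> :: real
      have "norm (f (cis \<theta>)) \<le> \<bar>B\<bar>"
        using bspec [OF B, of "cis \<theta>"] by simp
      then show "norm (f (cis \<theta>) * complex_of_real (indicator {0..<2*pi} \<theta> *\<^sub>R w (cis \<theta>)))
          \<le> norm (B * (indicator {0..<2*pi} \<theta> *\<^sub>R w (cis \<theta>)))"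
        by (simp add: norm_mult abs_mult mult_right_mono)
    qed
  qed measurable
  then show ?thesis
    unfolding set_integrable_def
    by (rule back_subst [of "integrable lborel"]) (auto simp: fun_eq_iff indicator_def)
qed

lemma weight_form_add_left:
  assumes "integrable_weight w"
  shows "weight_form w (P + P') Q = weight_form w P Q + weight_form w P' Q"
proof -
  have "set_integrable lborel {0..<2*pi}
      (\<lambda>\<theta>. poly R (cis \<theta>) * cnj (poly Q (cis \<theta>)) * complex_of_real (w (cis \<theta>)))" for R
    by (rule set_integrable_weight_mult [OF assms]) (intro continuous_intros)
  from set_integral_add(2) [OF this [of P] this [of P']] show ?thesis
    by (simp add: weight_form_def circle_integral_def algebra_simps add_divide_distrib)
qed

lemma weight_form_smult_left: "weight_form w (smult c P) Q = c * weight_form w P Q"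
  by (simp add: weight_form_def circle_integral_def mult.assoc)

lemma weight_form_0_left: "weight_form w 0 Q = 0"
  using weight_form_smult_left [of w 0 0 Q] by simp

lemma weight_form_sum_left:
  assumes "integrable_weight w"
  shows "weight_form w (\<Sum>i\<in>I. f i) Q = (\<Sum>i\<in>I. weight_form w (f i) Q)"
  by (induction I rule: infinite_finite_induct)
    (simp_all add: weight_form_0_left weight_form_add_left [OF assms])

lemma weight_form_commute: "weight_form w Q P = cnj (weight_form w P Q)"
  unfolding weight_form_def circle_integral_cnj [symmetric]
  by (intro arg_cong [where f = circle_integral]) (auto simp: mult_ac)

text \<open>The bound is phrased by vanishing coefficients instead of the degree: the zero
  polynomial has degree 0, yet it must satisfy the bound \<open>m = 0\<close>.\<close>

lemma poly_eq_sum_smult_monom: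
  fixes P :: "'a :: comm_semiring_1 poly"
  assumes "\<And>i. m \<le> i \<Longrightarrow> coeff P i = 0"
  shows "P = (\<Sum>i<m. smult (coeff P i) (monom 1 i))"
  by (rule poly_eqI) (use assms in \<open>auto simp: coeff_sum not_less if_distrib cong: if_cong\<close>)

lemma poly_eq_sum_lessThan:
  fixes P :: "'a :: comm_semiring_1 poly"
  assumes "\<And>i. m \<le> i \<Longrightarrow> coeff P i = 0"
  shows "poly P x = (\<Sum>i<m. coeff P i * x ^ i)"
proof -
  have "poly P x = poly (\<Sum>i<m. smult (coeff P i) (monom 1 i)) x"
    using poly_eq_sum_smult_monom [OF assms] by simp
  then show ?thesis
    by (simp add: poly_sum poly_monom)
qed

lemma weight_form_expand_left:
  assumes "integrable_weight w" and "\<And>i. m \<le> i \<Longrightarrow> coeff P i = 0"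
  shows "weight_form w P Q = (\<Sum>i<m. coeff P i * weight_form w (monom 1 i) Q)"
proof -
  have "weight_form w P Q = weight_form w (\<Sum>i<m. smult (coeff P i) (monom 1 i)) Q"
    using poly_eq_sum_smult_monom [OF assms(2)] by simp
  then show ?thesis
    by (simp only: weight_form_sum_left [OF assms(1)] weight_form_smult_left)
qed

lemma weight_form_expand_right:
  assumes "integrable_weight w" and "\<And>i. m \<le> i \<Longrightarrow> coeff Q i = 0"
  shows "weight_form w P Q = (\<Sum>i<m. cnj (coeff Q i) * weight_form w P (monom 1 i))"
  by (subst weight_form_commute, subst weight_form_expand_left [OF assms])
    (simp_all add: weight_form_commute [of w P])

section \<open>Pairing polynomials with type I linear forms\<close>

definition pairing ::
  "nat \<Rightarrow> (nat \<Rightarrow> complex \<Rightarrow> real) \<Rightarrow> complex poly \<Rightarrow> (nat \<Rightarrow> complex poly) \<Rightarrow> complex" where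
  "pairing s \<omega> P L = (\<Sum>j=1..s. weight_form (\<omega> j) P (L j))"

text \<open>The sum over the weights allows componentwise arguments, the single integral connects to
  the type I conditions. The two agree because every summand is integrable and the weights are real,
  hence fixed by conjugation.\<close>

lemma pairing_conv_circle_integral:
  assumes "\<forall>j\<in>{1..s}. integrable_weight (\<omega> j)"
  shows "pairing s \<omega> P L = circle_integral (\<lambda>z. poly P z * cnj (linear_form s \<omega> L z))"
proof -
  have "set_integrable lborel {0..<2*pi}
      (\<lambda>\<theta>. poly P (cis \<theta>) * cnj (poly (L j) (cis \<theta>)) * complex_of_real (\<omega> j (cis \<theta>)))"
    if "j \<in> {1..s}" for j
    using assms that by (intro set_integrable_weight_mult continuous_intros) auto
  then have "(LINT \<theta>:{0..<2*pi}|lborel. (\<Sum>j=1..s.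
        poly P (cis \<theta>) * cnj (poly (L j) (cis \<theta>)) * complex_of_real (\<omega> j (cis \<theta>)))) =
      (\<Sum>j=1..s. LINT \<theta>:{0..<2*pi}|lborel.
        poly P (cis \<theta>) * cnj (poly (L j) (cis \<theta>)) * complex_of_real (\<omega> j (cis \<theta>)))"
    unfolding set_lebesgue_integral_def set_integrable_def scaleR_sum_right
    by (rule Bochner_Integration.integral_sum)
  then show ?thesis
    by (simp add: pairing_def weight_form_def circle_integral_def linear_form_def
        sum_distrib_left sum_divide_distrib mult.assoc)
qed

lemma pairing_add:
  assumes "\<forall>j\<in>{1..s}. integrable_weight (\<omega> j)"
  shows "pairing s \<omega> (P + P') L = pairing s \<omega> P L + pairing s \<omega> P' L"
  using assms by (simp add: pairing_def weight_form_add_left sum.distrib)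

lemma pairing_smult: "pairing s \<omega> (smult c P) L = c * pairing s \<omega> P L"
  by (simp add: pairing_def weight_form_smult_left sum_distrib_left)

text \<open>On monomials below the size of the multi-index, the type I conditions give 0 except at
  the top exponent, where they give 1. Linearity does the rest.\<close>

lemma type_I_pairing:
  assumes w: "\<forall>j\<in>{1..s}. integrable_weight (\<omega> j)"
    and L: "is_type_I s \<omega> m L" and P: "degree P < mi_size s m"
  shows "pairing s \<omega> P L = coeff P (mi_size s m - 1)"
proof -
  have mon: "pairing s \<omega> (monom 1 k) L = (if k + 1 = mi_size s m then 1 else 0)"
    if "k < mi_size s m" for k
  proof -
    \<comment> \<open>The type I conditions concern the conjugate of the pairing; their prescribed
      values 0 and 1 are real.\<close>
    have "pairing s \<omega> (monom 1 k) L = cnj (circle_integral (\<lambda>z. linear_form s \<omega> L z * cnj (z ^ k)))"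
      by (simp add: pairing_conv_circle_integral [OF w] circle_integral_cnj [symmetric]
          poly_monom mult.commute)
    moreover have "mi_size s m - 1 = k" if "k + 1 = mi_size s m"
      using that by simp
    ultimately show ?thesis
      using L \<open>k < mi_size s m\<close> unfolding is_type_I_def by (cases "k + 1 = mi_size s m") auto
  qed
  have "pairing s \<omega> P L =
      (\<Sum>j=1..s. \<Sum>k<mi_size s m. coeff P k * weight_form (\<omega> j) (monom 1 k) (L j))"
    unfolding pairing_def
    by (intro sum.cong weight_form_expand_left) (use P w in \<open>auto simp: coeff_eq_0\<close>)
  also have "\<dots> = (\<Sum>k<mi_size s m. coeff P k * pairing s \<omega> (monom 1 k) L)"
    by (subst sum.swap) (simp add: pairing_def sum_distrib_left)
  also have "\<dots> = (\<Sum>k<mi_size s m. if k = mi_size s m - 1 then coeff P k else 0)"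
    by (intro sum.cong) (auto simp: mon)
  also have "\<dots> = coeff P (mi_size s m - 1)"
    using P by simp
  finally show ?thesis .
qed

text \<open>Each \<open>L j\<close> is a combination of the monomials to which \<open>P\<close> is
  orthogonal for the weight \<open>\<omega> j\<close>. The vector need only obey the degree bounds,
  so a type I vector of an earlier point of the path can be inserted.\<close>

lemma type_II_pairing_eq_0:
  assumes w: "\<forall>j\<in>{1..s}. integrable_weight (\<omega> j)"
    and P: "is_type_II s \<omega> m P"
    and L: "\<And>j. j \<in> {1..s} \<Longrightarrow> L j = 0 \<or> degree (L j) < m j"
  shows "pairing s \<omega> P L = 0"
proof -
  have "weight_form (\<omega> j) P (L j) = 0" if j: "j \<in> {1..s}" for j
  proof -
    have "weight_form (\<omega> j) P (L j) =
        (\<Sum>k<m j. cnj (coeff (L j) k) * weight_form (\<omega> j) P (monom 1 k))"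
      using L [OF j] w j by (intro weight_form_expand_right) (auto simp: coeff_eq_0)
    also have "\<dots> = 0"
      using P j by (auto simp: is_type_II_def weight_form_def poly_monom intro!: sum.neutral)
    finally show ?thesis .
  qed
  then show ?thesis
    by (simp add: pairing_def)
qed

text \<open>Induction on a bound \<open>d\<close> for the degree: a multiple of the monic
  \<open>\<Phi> d\<close> removes the top coefficient, and the remainder is expanded by
  induction.\<close>

lemma biorthogonal_expansion:
  fixes \<Phi> :: "nat \<Rightarrow> complex poly" and f :: "nat \<Rightarrow> complex poly \<Rightarrow> complex"
  assumes add: "\<And>j P Q. f j (P + Q) = f j P + f j Q"
    and smult: "\<And>j c P. f j (smult c P) = c * f j P"
    and deg: "\<And>j. j < n \<Longrightarrow> degree (\<Phi> j) = j \<and> coeff (\<Phi> j) j = 1"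
    and biorth: "\<And>i j. i < n \<Longrightarrow> j < n \<Longrightarrow> f j (\<Phi> i) = (if i = j then 1 else 0)"
    and P: "\<And>i. n \<le> i \<Longrightarrow> coeff P i = 0"
  shows "P = (\<Sum>j<n. smult (f j P) (\<Phi> j))"
proof -
  have f_sum: "f j (\<Sum>i<d. g i) = (\<Sum>i<d. f j (g i))" for j g and d :: nat
  proof -
    have f_0: "f j 0 = 0"
      using smult [of j 0 0] by simp
    show ?thesis
      by (induction d) (simp_all add: add f_0)
  qed
  have "P = (\<Sum>j<d. smult (f j P) (\<Phi> j))" if "d \<le> n" "\<And>i. d \<le> i \<Longrightarrow> coeff P i = 0" for d P
    using that
  proof (induction d arbitrary: P)
    case 0
    then show ?case by (simp add: poly_eq_iff)
  next
    case (Suc d)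
    define c where "c = coeff P d"
    \<comment> \<open>Written with \<open>+\<close> and a negative scalar because \<open>f\<close>
      is only assumed additive and homogeneous.\<close>
    define R where "R = P + smult (- c) (\<Phi> d)"
    have f_R: "f j R = f j P - c * f j (\<Phi> d)" for j
      unfolding R_def add smult by simp
    have "coeff R i = 0" if "d \<le> i" for i
      using that Suc.prems deg [of d] coeff_eq_0 [of "\<Phi> d" i]
      by (cases "i = d") (auto simp: R_def c_def)
    then have R: "R = (\<Sum>j<d. smult (f j R) (\<Phi> j))"
      using Suc by simp
    \<comment> \<open>The remainder is a combination of earlier \<open>\<Phi> j\<close>, which
      \<open>f d\<close> annihilates; so \<open>f d P\<close> is exactly the removed
      coefficient.\<close>
    have "f d R = (\<Sum>j<d. f j R * f d (\<Phi> j))"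
      by (subst R) (simp add: f_sum smult)
    also have "\<dots> = 0"
      using Suc.prems(1) by (intro sum.neutral) (auto simp: biorth)
    finally have "f d P = c"
      using Suc.prems(1) by (simp add: f_R biorth)
    moreover have "f j R = f j P" if "j < d" for j
      using that Suc.prems(1) by (simp add: f_R biorth)
    moreover have "P = R + smult c (\<Phi> d)"
      by (simp add: R_def)
    ultimately show ?case
      using R by simp
  qed
  from this [OF order_refl P] show ?thesis .
qed

section \<open>The natural path and the expansion along it\<close>

lemma mi_size_natural_path: "mi_size s (natural_path m j) = min j (mi_size s m)"
proof (induction s)
  case (Suc s)
  \<comment> \<open>The first \<open>s\<close> components absorb as much of \<open>j\<close> as they
    can hold; truncated subtraction leaves the rest for the next one.\<close>
  have "{1..<Suc s} = {1..s}" by auto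
  then show ?case
    using Suc by (simp add: mi_size_def natural_path_def)
qed (simp add: mi_size_def)

lemma natural_path_mono: "j \<le> j' \<Longrightarrow> natural_path m j i \<le> natural_path m j' i"
  by (auto simp: natural_path_def)

lemma natural_path_le: "natural_path m j i \<le> m i"
  by (simp add: natural_path_def)

lemma natural_path_end:
  assumes "i \<in> {1..s}"
  shows "natural_path m (mi_size s m) i = m i"
proof -
  have "(\<Sum>l=1..<i. m l) + m i = (\<Sum>l\<in>{1..i}. m l)"
    using assms by (cases i) (auto simp: atLeastLessThanSuc_atLeastAtMost)
  also have "\<dots> \<le> mi_size s m"
    unfolding mi_size_def using assms by (intro sum_mono2) auto
  finally show ?thesis
    by (simp add: natural_path_def)
qed

text \<open>Biorthogonality has two sources. For \<open>i \<le> j\<close> the degree of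
  \<open>\<Phi> i\<close> is small enough for the pairing to read off its coefficient at
  \<open>j\<close>. For \<open>i > j\<close> the path is monotone, so the degree bounds of
  \<open>\<Lambda> j\<close> fall under the orthogonality conditions of
  \<open>\<Phi> i\<close>.\<close>

lemma poly_eq_CD_expansion:
  assumes w: "\<forall>j\<in>{1..s}. integrable_weight (\<omega> j)"
    and II: "\<And>j. j < mi_size s m \<Longrightarrow> is_type_II s \<omega> (natural_path m j) (\<Phi> j)"
    and I: "\<And>j. j < mi_size s m \<Longrightarrow> is_type_I s \<omega> (natural_path m (j + 1)) (\<Lambda> j)"
    and P: "\<And>i. mi_size s m \<le> i \<Longrightarrow> coeff P i = 0"
  shows "poly P z = (\<Sum>j<mi_size s m. pairing s \<omega> P (\<Lambda> j) * poly (\<Phi> j) z)"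
proof -
  have deg: "degree (\<Phi> j) = j \<and> coeff (\<Phi> j) j = 1" if "j < mi_size s m" for j
    using II [OF that] that by (auto simp: is_type_II_def mi_size_natural_path)
  have "P = (\<Sum>j<mi_size s m. smult (pairing s \<omega> P (\<Lambda> j)) (\<Phi> j))"
  proof (rule biorthogonal_expansion)
    fix i j assume ij: "i < mi_size s m" "j < mi_size s m"
    show "pairing s \<omega> (\<Phi> i) (\<Lambda> j) = (if i = j then 1 else 0)"
    proof (cases "i \<le> j")
      case True
      have "pairing s \<omega> (\<Phi> i) (\<Lambda> j) = coeff (\<Phi> i) j"
        using type_I_pairing [OF w I [OF ij(2)], of "\<Phi> i"] deg [OF ij(1)] True ij
        by (simp add: mi_size_natural_path)
      then show ?thesis
        using deg [OF ij(1)] True by (auto simp: coeff_eq_0)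
    next
      case False
      have "pairing s \<omega> (\<Phi> i) (\<Lambda> j) = 0"
      proof (rule type_II_pairing_eq_0 [OF w II [OF ij(1)]])
        fix l assume "l \<in> {1..s}"
        then show "\<Lambda> j l = 0 \<or> degree (\<Lambda> j l) < natural_path m i l"
          using I [OF ij(2)] natural_path_mono [of "j + 1" i m l] False
          by (fastforce simp: is_type_I_def)
      qed
      with False show ?thesis by simp
    qed
  qed (use deg P in \<open>simp_all add: pairing_add [OF w] pairing_smult\<close>)
  then have "poly P z = poly (\<Sum>j<mi_size s m. smult (pairing s \<omega> P (\<Lambda> j)) (\<Phi> j)) z"
    by simp
  then show ?thesis
    by (simp add: poly_sum)
qed

text \<open>Vieta's formula: expand the product over subsets and group the subsets by
  cardinality.\<close>

lemma prod_diff_conv_elem_sym: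
  assumes "finite A"
  shows "(\<Prod>i\<in>A. t - x i) =
    (\<Sum>k\<le>card A. (- 1) ^ (card A - k) * elem_sym (card A - k) A x * (t :: 'a :: comm_ring_1) ^ k)"
proof -
  have "(\<Prod>i\<in>A. t - x i) = (\<Sum>S\<in>Pow A. (- 1) ^ card S * (\<Prod>i\<in>S. x i) * t ^ (card A - card S))"
    using assms by (subst prod_diff_conv_sum)
      (auto intro!: sum.cong simp: card_Diff_subset finite_subset)
  also have "\<dots> = (\<Sum>s\<le>card A. \<Sum>S | S \<in> Pow A \<and> card S = s.
      (- 1) ^ card S * (\<Prod>i\<in>S. x i) * t ^ (card A - card S))"
    using assms by (intro sum.group [symmetric]) (auto simp: card_mono)
  also have "\<dots> = (\<Sum>s\<le>card A. (- 1) ^ s * elem_sym s A x * t ^ (card A - s))"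
    by (intro sum.cong) (auto simp: elem_sym_def sum_distrib_left sum_distrib_right mult_ac)
  also have "\<dots> = (\<Sum>k\<le>card A. (- 1) ^ (card A - k) * elem_sym (card A - k) A x * t ^ k)"
    by (rule sum.reindex_bij_witness [of _ "\<lambda>k. card A - k" "\<lambda>k. card A - k"]) auto
  finally show ?thesis .
qed

section \<open>Moments of the uniform weight and of an arc\<close>

lemma set_integral_cis:
  fixes c s t :: real
  assumes "s \<le> t" "c \<noteq> 0"
  shows "(LINT \<theta>:{s..t}|lborel. cis (c * \<theta>)) = (cis (c * t) - cis (c * s)) / (\<i> * c)"
proof -
  have "((\<lambda>\<theta>. cis (c * \<theta>) / (\<i> * c)) has_vector_derivative cis (c * \<theta>)) (at \<theta> within {s..t})" for \<theta>
    using assms(2) unfolding has_vector_derivative_def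
    by (auto intro!: derivative_eq_intros simp: scaleR_conv_of_real mult_ac)
  from integral_FTC_atLeastAtMost [OF assms(1) this] show ?thesis
    unfolding set_lebesgue_integral_def
    by (simp add: continuous_intros diff_divide_distrib)
qed

text \<open>Monomials are orthonormal for the uniform weight. Only \<open>Q\<close> carries a bound,
  so coefficients of \<open>P\<close> from \<open>m\<close> on do not contribute.\<close>

lemma weight_form_uniform:
  assumes w: "\<forall>\<theta>\<in>{0..<2*pi}. w (cis \<theta>) = 1"
    and Q: "\<And>i. m \<le> i \<Longrightarrow> coeff Q i = 0"
  shows "weight_form w P Q = (\<Sum>i<m. coeff P i * cnj (coeff Q i))"
proof -
  have "set_integrable lborel {0..<2*pi} (\<lambda>\<theta>. 1 :: real)"
    by (simp add: set_integrable_def)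
  then have int: "integrable_weight w"
    unfolding integrable_weight_def using w by (subst set_integrable_cong) auto
  have mon: "weight_form w (monom 1 i) (monom 1 k) = (if i = k then 1 else 0)" for i k
  proof -
    have "(LINT \<theta>:{0..<2*pi}|lborel.
          poly (monom 1 i) (cis \<theta>) * cnj (poly (monom 1 k) (cis \<theta>)) * complex_of_real (w (cis \<theta>))) =
        (LINT \<theta>:{0..<2*pi}|lborel. cis ((real i - real k) * \<theta>))"
      by (rule set_lebesgue_integral_cong)
        (auto simp: w poly_monom Complex.DeMoivre cis_cnj cis_mult algebra_simps)
    \<comment> \<open>Adding the null set \<open>{2*pi}\<close> gives the closed interval on which
      the antiderivative is evaluated.\<close>
    also have "\<dots> = (LINT \<theta>:{0..2*pi}|lborel. cis ((real i - real k) * \<theta>))"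
      by (rule set_integral_discrete_difference [of "{2*pi}"]) auto
    also have "\<dots> = (if i = k then complex_of_real (2*pi) else 0)"
    proof (cases "i = k")
      case True
      then show ?thesis
        by (simp add: set_lebesgue_integral_def scaleR_conv_of_real)
    next
      case False
      have "cis ((real i - real k) * (2*pi)) = 1"
        using cis_multiple_2pi [of "real i - real k"] by (simp add: mult_ac)
      with False show ?thesis
        by (subst set_integral_cis) auto
    qed
    finally show ?thesis
      by (simp add: weight_form_def circle_integral_def)
  qed
  have "weight_form w P (monom 1 k) = coeff P k" for k
  proof -
    \<comment> \<open>Large enough to cover \<open>P\<close> and also the index \<open>k\<close>,
      which may exceed the degree of \<open>P\<close>.\<close>
    define d where "d = Suc (max k (degree P))"
    then have "weight_form w P (monom 1 k) =
        (\<Sum>i<d. coeff P i * weight_form w (monom 1 i) (monom 1 k))"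
      by (intro weight_form_expand_left [OF int]) (auto intro: coeff_eq_0)
    moreover have "k < d"
      by (simp add: d_def)
    ultimately show ?thesis
      by (simp add: mon if_distrib cong: if_cong)
  qed
  then show ?thesis
    by (simp add: weight_form_expand_right [OF int Q] mult.commute)
qed

text \<open>Factoring out the phase of the midpoint leaves a difference of conjugate exponentials,
  that is, a sine of half the arc length. The real factor thus depends on the arc only through its
  length.\<close>

lemma weight_form_arc_monom:
  assumes w: "\<forall>\<theta>\<in>{0..<2*pi}. w (cis \<theta>) = indicator {\<alpha>..\<beta>} \<theta>"
    and sub: "{\<alpha>..\<beta>} \<subseteq> {0..<2*pi}" and le: "\<alpha> \<le> \<beta>"
  shows "weight_form w (monom 1 l) 1 =
    complex_of_real (if l = 0 then (\<beta> - \<alpha>) / (2*pi) else 1 / (l * pi) * sin (l * (\<beta> - \<alpha>) / 2))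
      * cis ((\<alpha> + \<beta>) / 2) ^ l"
proof -
  have "(LINT \<theta>:{0..<2*pi}|lborel.
      poly (monom 1 l) (cis \<theta>) * cnj (poly 1 (cis \<theta>)) * complex_of_real (w (cis \<theta>))) =
      (LINT \<theta>:{\<alpha>..\<beta>}|lborel. cis (l * \<theta>))"
    unfolding set_lebesgue_integral_def
    by (rule Bochner_Integration.integral_cong)
      (use sub in \<open>auto simp: w poly_monom Complex.DeMoivre indicator_def\<close>)
  also have "\<dots> / complex_of_real (2*pi) =
      complex_of_real (if l = 0 then (\<beta> - \<alpha>) / (2*pi) else 1 / (l * pi) * sin (l * (\<beta> - \<alpha>) / 2))
      * cis ((\<alpha> + \<beta>) / 2) ^ l"
  proof (cases "l = 0")
    case True
    with le show ?thesis
      by (simp add: set_lebesgue_integral_def scaleR_conv_of_real)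
  next
    case False
    have "cis (l * \<beta>) - cis (l * \<alpha>) = cis (l * ((\<alpha> + \<beta>) / 2)) *
        (cis (l * (\<beta> - \<alpha>) / 2) - cis (- (l * (\<beta> - \<alpha>) / 2)))"
      by (simp add: right_diff_distrib cis_mult field_simps)
    also have "cis (l * (\<beta> - \<alpha>) / 2) - cis (- (l * (\<beta> - \<alpha>) / 2)) = 2 * \<i> * sin (l * (\<beta> - \<alpha>) / 2)"
      by (simp add: complex_eq_iff)
    finally have "(LINT \<theta>:{\<alpha>..\<beta>}|lborel. cis (l * \<theta>)) =
        cis (l * ((\<alpha> + \<beta>) / 2)) * (2 * \<i> * sin (l * (\<beta> - \<alpha>) / 2)) / (\<i> * l)"
      using set_integral_cis [OF le, of "real l"] False by simp
    with False show ?thesis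
      by (simp add: Complex.DeMoivre mult_ac)
  qed
  finally show ?thesis
    by (simp add: weight_form_def circle_integral_def)
qed

lemma integrable_weight_arc:
  assumes "\<forall>\<theta>\<in>{0..<2*pi}. w (cis \<theta>) = indicator {\<alpha>..\<beta>} \<theta>"
  shows "integrable_weight w"
proof -
  have "set_integrable lborel {0..<2*pi} (\<lambda>\<theta>. indicator {\<alpha>..\<beta>} \<theta> :: real)"
    unfolding set_integrable_def real_scaleR_def indicator_inter_arith [symmetric]
    by (intro integrable_real_indicator emeasure_bounded_finite bounded_Int) auto
  then show ?thesis
    unfolding integrable_weight_def using assms by (subst set_integrable_cong) auto
qed

lemma integrable_weight_uniform:
  assumes "\<forall>\<theta>\<in>{0..<2*pi}. w (cis \<theta>) = 1"
  shows "integrable_weight w"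
  using integrable_weight_arc [of w 0 "2*pi"] assms by simp

lemma sum_from_1_split: "(\<Sum>j=1..r+1. f j) = f 1 + (\<Sum>p=1..r. f (p + 1))" for r :: nat
  by (simp add: sum.atLeast_Suc_atMost sum.shift_bounds_cl_Suc_ivl del: sum.cl_ivl_Suc)

text \<open>There are \<open>r - 1\<close> nodes besides \<open>p\<close>, hence the exponents
  \<open>k - 1\<close>. At \<open>t = x q\<close> the product is the numerator of a Lagrange basis
  polynomial.\<close>

lemma sum_elem_sym_nodes:
  fixes x :: "nat \<Rightarrow> 'a :: comm_ring_1"
  assumes "p \<in> {1..r}"
  shows "(\<Sum>k=1..r. (- 1) ^ (r - k) * elem_sym (r - k) ({1..r} - {p}) x * t ^ (k - 1)) =
    (\<Prod>i\<in>{1..r} - {p}. t - x i)"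
proof -
  have "card ({1..r} - {p}) = r - 1"
    using assms by simp
  then have "(\<Prod>i\<in>{1..r} - {p}. t - x i) =
      (\<Sum>k\<le>r-1. (- 1) ^ (r - 1 - k) * elem_sym (r - 1 - k) ({1..r} - {p}) x * t ^ k)"
    by (simp add: prod_diff_conv_elem_sym)
  also have "\<dots> = (\<Sum>k=1..r. (- 1) ^ (r - k) * elem_sym (r - k) ({1..r} - {p}) x * t ^ (k - 1))"
    by (rule sum.reindex_bij_witness [of _ "\<lambda>k. k - 1" Suc]) (use assms in auto)
  finally show ?thesis by simp
qed

section \<open>The difference of the two kernels\<close>

theorem corollary3p10:
  fixes r n :: nat
    and \<alpha> \<beta> :: "nat \<Rightarrow> real" and \<Delta> :: real
    and E :: "nat \<Rightarrow> real set"
    and \<nu> :: "nat \<Rightarrow> nat"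
    and \<omega> :: "nat \<Rightarrow> complex \<Rightarrow> real"
    and x :: "nat \<Rightarrow> complex" and a :: "nat \<Rightarrow> real"
    and z \<xi> :: complex
  assumes "1 \<le> r" and "r < n"
    and "\<And>j. j \<in> {1..r} \<Longrightarrow> E j = {\<alpha> j..\<beta> j}"
    and "\<And>j. j \<in> {1..r} \<Longrightarrow> E j \<subseteq> {0..<2 * pi}"
    and "disjoint_family_on E {1..r}"
    and "0 < \<Delta>" and "\<And>j. j \<in> {1..r} \<Longrightarrow> \<beta> j - \<alpha> j = \<Delta>"
    and "\<nu> 1 = n - r" and "\<And>j. j \<in> {1..r} \<Longrightarrow> \<nu> (j + 1) = 1"
    and "\<And>\<theta>. \<theta> \<in> {0..<2 * pi} \<Longrightarrow> \<omega> 1 (cis \<theta>) = 1"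
    and "\<And>j \<theta>. j \<in> {1..r} \<Longrightarrow> \<theta> \<in> {0..<2 * pi} \<Longrightarrow> \<omega> (j + 1) (cis \<theta>) = indicator (E j) \<theta>"
    and "\<And>j. j \<in> {1..n} \<Longrightarrow> \<exists>!P. is_type_II (r + 1) \<omega> (natural_path \<nu> j) P"
    and "\<And>j. j \<in> {1..n} \<Longrightarrow> \<exists>!L. is_type_I (r + 1) \<omega> (natural_path \<nu> j) L"
    and "\<And>j. j \<in> {1..r} \<Longrightarrow> x j = cis ((\<alpha> j + \<beta> j) / 2)"
    and "a 0 = \<Delta> / (2 * pi)"
    and "\<And>l. l \<noteq> 0 \<Longrightarrow> a l = 1 / (real l * pi) * sin (real l * \<Delta> / 2)"
    and "norm \<xi> = 1"
  shows "CD_kernel (r + 1) \<omega> \<nu> z \<xi> - (\<Sum>j<n. (z * cnj \<xi>) ^ j) =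
    (\<Sum>p=1..r.
       (indicator (E p) (Arg2pi \<xi>)
          - (\<Sum>j<n. \<xi> powi (- int j) * complex_of_real (a j) * x p ^ j)) *
       (x p powi (- int (n - r)) / (\<Prod>m\<in>{1..r} - {p}. x p - x m) *
          (\<Sum>k=1..r. (- 1) ^ (r - k) * elem_sym (r - k) ({1..r} - {p}) x *
             (z ^ (n - r + k - 1) / complex_of_real (a (n - r + k - 1))))))"
proof -
  define N where "N = n - r"
  define \<Phi> where "\<Phi> j = type_II (r + 1) \<omega> (natural_path \<nu> j)" for j
  define \<Lambda> where "\<Lambda> j = type_I (r + 1) \<omega> (natural_path \<nu> (j + 1))" for j
  \<comment> \<open>Chosen so that \<open>G p\<close> evaluated at \<open>z\<close> is the second
    factor of the claim; the exponents \<open>N + k - 1\<close> run from \<open>N\<close> to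
    \<open>n - 1\<close>.\<close>
  define g where "g p k = x p powi (- int N) / (\<Prod>m\<in>{1..r} - {p}. x p - x m) *
    ((- 1) ^ (r - k) * elem_sym (r - k) ({1..r} - {p}) x / complex_of_real (a (N + k - 1)))" for p k
  define G where "G p = (\<Sum>k=1..r. monom (g p k) (N + k - 1))" for p
  define \<mu> where "\<mu> p P = weight_form (\<omega> (p + 1)) P 1" for p P
  define \<iota> :: "nat \<Rightarrow> complex" where "\<iota> p = indicator (E p) (Arg2pi \<xi>)" for p
  note r = assms(1) and n = assms(2) and E = assms(3) and E_sub = assms(4) and disj = assms(5)
    and \<Delta> = assms(6) and len = assms(7) and \<nu> = assms(8,9) and \<omega>E = assms(11)
    and ex_II = assms(12) and ex_I = assms(13) and x = assms(14) and a = assms(15,16)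
    and \<xi> = assms(17)
  have \<omega>1: "\<forall>\<theta>\<in>{0..<2*pi}. \<omega> 1 (cis \<theta>) = 1"
    using assms(10) by blast
  have N: "0 < N" "n = N + r"
    using r n by (auto simp: N_def)
  have size: "mi_size (r + 1) \<nu> = n"
    unfolding mi_size_def sum_from_1_split using \<nu> n by simp

  have arc: "\<forall>\<theta>\<in>{0..<2*pi}. \<omega> (p + 1) (cis \<theta>) = indicator {\<alpha> p..\<beta> p} \<theta>" if "p \<in> {1..r}" for p
    using \<omega>E [OF that] E [OF that] by simp
  have arc_sub: "{\<alpha> p..\<beta> p} \<subseteq> {0..<2*pi}" and arc_le: "\<alpha> p \<le> \<beta> p" if "p \<in> {1..r}" for p
    using E_sub [OF that] E [OF that] len [OF that] \<Delta> by auto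
  have w: "\<forall>j\<in>{1..r+1}. integrable_weight (\<omega> j)"
  proof
    fix j assume j: "j \<in> {1..r+1}"
    show "integrable_weight (\<omega> j)"
    proof (cases "j = 1")
      case True
      then show ?thesis using integrable_weight_uniform [OF \<omega>1] by simp
    next
      case False
      then have "j - 1 \<in> {1..r}" "j - 1 + 1 = j" using j by auto
      then show ?thesis using integrable_weight_arc [OF arc, of "j - 1"] by simp
    qed
  qed
  have w': "integrable_weight (\<omega> (p + 1))" if "p \<in> {1..r}" for p
    using w that by simp

  have x_nz: "x p \<noteq> 0" if "p \<in> {1..r}" for p
    using x [OF that] by simp
  \<comment> \<open>The midpoint angles lie in \<open>{0..<2*pi}\<close> and are recovered by
    \<open>Arg2pi\<close>. Equal midpoints and equal lengths would make two nonempty disjoint arcs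
    coincide.\<close>
  have x_inj: "x p \<noteq> x q" if pq: "p \<in> {1..r}" "q \<in> {1..r}" "p \<noteq> q" for p q
  proof
    assume "x p = x q"
    have ends: "\<alpha> i \<in> {0..<2*pi}" "\<beta> i \<in> {0..<2*pi}" if "i \<in> {1..r}" for i
      using arc_sub [OF that] arc_le [OF that] by auto
    have arg: "Arg2pi (x i) = (\<alpha> i + \<beta> i) / 2" if "i \<in> {1..r}" for i
      using ends [OF that] x [OF that] by (intro Arg2pi_unique [of 1]) (auto simp: cis_conv_exp)
    have "\<alpha> p + \<beta> p = \<alpha> q + \<beta> q"
      using arg pq \<open>x p = x q\<close> by (metis divide_cancel_right zero_neq_numeral)
    then have "E p = E q"
      using E len pq by (simp add: algebra_simps)
    moreover have "E p \<inter> E q = {}"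
      using disj pq by (auto simp: disjoint_family_on_def)
    moreover have "\<alpha> p \<in> E p"
      using E pq arc_le by simp
    ultimately show False by auto
  qed

  have \<mu>_smult: "\<mu> p (smult c P) = c * \<mu> p P" for p c P
    by (simp add: \<mu>_def weight_form_smult_left)
  have \<mu>_monom: "\<mu> p (monom c l) = c * (complex_of_real (a l) * x p ^ l)" if p: "p \<in> {1..r}" for p c l
  proof -
    have "weight_form (\<omega> (p + 1)) (monom 1 l) 1 = complex_of_real (a l) * x p ^ l"
      using weight_form_arc_monom [OF arc [OF p] arc_sub [OF p] arc_le [OF p], of l] p a len x
      by simp
    moreover have "monom c l = smult c (monom 1 l)"
      by (simp add: smult_monom)
    ultimately show ?thesis
      by (simp add: \<mu>_def weight_form_smult_left)
  qed
  have \<mu>_sum: "\<mu> p (\<Sum>i\<in>I. f i) = (\<Sum>i\<in>I. \<mu> p (f i))" if "p \<in> {1..r}" for p f and I :: "nat set"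
    using w' [OF that] by (simp add: \<mu>_def weight_form_sum_left)

  \<comment> \<open>The existence hypothesis starts at index 1. At index 0 there is no orthogonality
    condition, and 1 is the only monic polynomial of degree 0.\<close>
  have II: "is_type_II (r + 1) \<omega> (natural_path \<nu> j) (\<Phi> j)" if "j < n" for j
  proof (cases "j = 0")
    case True
    have "natural_path \<nu> 0 = (\<lambda>_. 0)"
      by (auto simp: natural_path_def)
    then have "is_type_II (r + 1) \<omega> (natural_path \<nu> 0) P \<longleftrightarrow> P = 1" for P
      by (auto simp: is_type_II_def mi_size_def elim: degree_eq_zeroE)
    then show ?thesis
      using True by (simp add: \<Phi>_def type_II_def)
  next
    case False
    then show ?thesis
      unfolding \<Phi>_def type_II_def using that by (intro theI' [OF ex_II]) auto
  qed
  have I: "is_type_I (r + 1) \<omega> (natural_path \<nu> (j + 1)) (\<Lambda> j)" if "j < n" for j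
    unfolding \<Lambda>_def type_I_def using that by (intro theI' [OF ex_I]) auto
  \<comment> \<open>The path stays below \<open>\<nu>\<close>, so at each of its points the first
    component has degree below \<open>N\<close> and, as shown next, the arc components are
    constants.\<close>
  have \<Lambda>1: "coeff (\<Lambda> j 1) l = 0" if "j < n" "N \<le> l" for j l
  proof -
    have "\<Lambda> j 1 = 0 \<or> degree (\<Lambda> j 1) < natural_path \<nu> (j + 1) 1"
      using I [OF that(1)] by (simp add: is_type_I_def)
    then show ?thesis
      using natural_path_le [of \<nu> "j + 1" 1] \<nu>(1) that(2) by (auto simp: N_def coeff_eq_0)
  qed
  have \<Lambda>p: "\<Lambda> j (p + 1) = [:coeff (\<Lambda> j (p + 1)) 0:]" if "j < n" "p \<in> {1..r}" for j p
  proof -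
    have "\<Lambda> j (p + 1) = 0 \<or> degree (\<Lambda> j (p + 1)) < natural_path \<nu> (j + 1) (p + 1)"
      using I [OF that(1)] that(2) by (simp add: is_type_I_def)
    then have "degree (\<Lambda> j (p + 1)) = 0"
      using natural_path_le [of \<nu> "j + 1" "p + 1"] \<nu>(2) [OF that(2)] by auto
    then show ?thesis
      by (auto elim: degree_eq_zeroE)
  qed

  have a_nz: "a l \<noteq> 0" if l: "N \<le> l" "l < n" for l
  proof
    assume a0: "a l = 0"
    \<comment> \<open>Then \<open>z\<^sup>l\<close> has zero moments against all weights, so it may be added to \<open>\<Phi>\<^sub>n\<close>.\<close>
    have nu_end: "natural_path \<nu> n i = \<nu> i" if "i \<in> {1..r+1}" for i
      using natural_path_end [OF that, of \<nu>] size by simp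
    obtain P where P: "is_type_II (r + 1) \<omega> (natural_path \<nu> n) P"
      and uniq: "\<And>Q. is_type_II (r + 1) \<omega> (natural_path \<nu> n) Q \<Longrightarrow> Q = P"
      using ex_II [of n] n by (auto simp: Ex1_def)
    have deg_P: "degree P = n" and lc_P: "lead_coeff P = 1"
      using P by (auto simp: is_type_II_def mi_size_natural_path size [simplified])
    \<comment> \<open>As \<open>l < n\<close>, adding this monomial changes neither the degree nor
      the leading coefficient.\<close>
    have deg: "degree (P + monom 1 l) = n"
      using l deg_P degree_monom_le [of "1 :: complex" l] by (subst degree_add_eq_left) auto
    \<comment> \<open>For the uniform weight, \<open>k < N \<le> l\<close> separates the exponents.
      An arc weight imposes only \<open>k = 0\<close>, where the moment is a multiple of
      \<open>a l\<close>.\<close>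
    have orth: "weight_form (\<omega> j) (monom 1 l) (monom 1 k) = 0"
      if j: "j \<in> {1..r+1}" and k: "k < natural_path \<nu> n j" for j k
    proof (cases "j = 1")
      case True
      then show ?thesis
        using k l \<nu>(1) nu_end [OF j] weight_form_uniform [OF \<omega>1, of "Suc k" "monom 1 k" "monom 1 l"]
        by (auto simp: N_def intro!: sum.neutral)
    next
      case False
      then have "j - 1 \<in> {1..r}" "j - 1 + 1 = j" using j by auto
      then have "k = 0" "weight_form (\<omega> j) (monom 1 l) 1 = 0"
        using \<nu>(2) [of "j - 1"] nu_end [OF j] k \<mu>_monom [of "j - 1" 1 l] a0 by (auto simp: \<mu>_def)
      then show ?thesis by (simp add: monom_0 one_pCons)
    qed
    have "is_type_II (r + 1) \<omega> (natural_path \<nu> n) (P + monom 1 l)"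
      unfolding is_type_II_def
    proof (intro conjI ballI allI impI)
      show "lead_coeff (P + monom 1 l) = 1"
        using deg deg_P lc_P l by simp
      fix j k assume j: "j \<in> {1..r+1}" and k: "k < natural_path \<nu> n j"
      have "weight_form (\<omega> j) (P + monom 1 l) (monom 1 k) = 0"
        using P j k w orth [OF j k]
        by (subst weight_form_add_left) (auto simp: is_type_II_def weight_form_def poly_monom)
      then show "circle_integral
          (\<lambda>z. poly (P + monom 1 l) z * cnj (z ^ k) * complex_of_real (\<omega> j z)) = 0"
        by (simp add: weight_form_def poly_monom)
    qed (use deg in \<open>simp add: mi_size_natural_path size [simplified]\<close>)
    then have "monom (1 :: complex) l = 0"
      using uniq by fastforce
    then show False
      by (simp add: monom_eq_0_iff)
  qed

  \<comment> \<open>Polynomials dual to the arc moments\<close>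
  have poly_G: "poly (G p) z = x p powi (- int N) / (\<Prod>m\<in>{1..r} - {p}. x p - x m) *
      (\<Sum>k=1..r. (- 1) ^ (r - k) * elem_sym (r - k) ({1..r} - {p}) x *
         (z ^ (N + k - 1) / complex_of_real (a (N + k - 1))))" for p
    by (simp add: G_def g_def poly_sum poly_monom sum_distrib_left mult_ac)
  have coeff_G: "coeff (G p) l = 0" if "l < N \<or> n \<le> l" for p l
    unfolding G_def coeff_sum using that N by (intro sum.neutral) auto
  \<comment> \<open>The moments \<open>a\<^sub>l x\<^sub>q\<^sup>l\<close> turn \<open>G p\<close> into a Lagrange basis polynomial evaluated at \<open>x q\<close>.\<close>
  have \<mu>_G: "\<mu> q (G p) = (if p = q then 1 else 0)" if p: "p \<in> {1..r}" and q: "q \<in> {1..r}" for p q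
  proof -
    let ?D = "\<Prod>m\<in>{1..r} - {p}. x p - x m"
    have "\<mu> q (G p) = (\<Sum>k=1..r. x p powi (- int N) / ?D * x q ^ N *
        ((- 1) ^ (r - k) * elem_sym (r - k) ({1..r} - {p}) x * x q ^ (k - 1)))"
      unfolding G_def \<mu>_sum [OF q]
    proof (rule sum.cong)
      fix k assume k: "k \<in> {1..r}"
      have "a (N + k - 1) \<noteq> 0"
        using k N by (intro a_nz) auto
      moreover have "x q ^ (N + k - 1) = x q ^ N * x q ^ (k - 1)"
        using k by (simp flip: power_add)
      ultimately show "\<mu> q (monom (g p k) (N + k - 1)) = x p powi (- int N) / ?D * x q ^ N *
          ((- 1) ^ (r - k) * elem_sym (r - k) ({1..r} - {p}) x * x q ^ (k - 1))"
        by (simp add: \<mu>_monom [OF q] g_def)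
    qed simp
    also have "\<dots> = x p powi (- int N) / ?D * x q ^ N * (\<Prod>m\<in>{1..r} - {p}. x q - x m)"
      by (simp only: sum_elem_sym_nodes [OF p] flip: sum_distrib_left)
    \<comment> \<open>For \<open>p = q\<close> the product and the power of \<open>x p\<close>
      cancel; otherwise the factor with \<open>m = q\<close> vanishes.\<close>
    also have "\<dots> = (if p = q then 1 else 0)"
    proof (cases "p = q")
      case True
      have "?D \<noteq> 0"
        using x_inj p by (auto simp: prod_zero_iff)
      then show ?thesis
        using True x_nz [OF p] by (simp add: power_int_minus)
    next
      case False
      then have "(\<Prod>m\<in>{1..r} - {p}. x q - x m) = 0"
        using q by (intro prod_zero) auto
      with False show ?thesis by simp
    qed
    finally show ?thesis .
  qed

  \<comment> \<open>Coefficients of the kernel in the conjugated type I data\<close>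
  have pair: "pairing (r + 1) \<omega> P (\<Lambda> j) =
      (\<Sum>l<N. coeff P l * cnj (coeff (\<Lambda> j 1) l)) + (\<Sum>p=1..r. cnj (coeff (\<Lambda> j (p + 1)) 0) * \<mu> p P)"
    if j: "j < n" for P j
  proof -
    have "weight_form (\<omega> (p + 1)) P (\<Lambda> j (p + 1)) = cnj (coeff (\<Lambda> j (p + 1)) 0) * \<mu> p P"
      if p: "p \<in> {1..r}" for p
      using weight_form_expand_right [OF w' [OF p], of 1 "[:coeff (\<Lambda> j (p + 1)) 0:]" P]
      by (subst \<Lambda>p [OF j p]) (simp add: \<mu>_def coeff_eq_0)
    moreover have "weight_form (\<omega> 1) P (\<Lambda> j 1) = (\<Sum>l<N. coeff P l * cnj (coeff (\<Lambda> j 1) l))"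
      by (rule weight_form_uniform [OF \<omega>1 \<Lambda>1 [OF j]])
    ultimately show ?thesis
      unfolding pairing_def sum_from_1_split by simp
  qed
  note expand = poly_eq_CD_expansion [of "r + 1" \<omega> \<nu> \<Phi> \<Lambda>, unfolded size, OF w II I]
  \<comment> \<open>\<open>G p\<close> has no coefficients below \<open>N\<close> and its only
    nonzero arc moment is the \<open>p\<close>-th, so the pairing isolates one arc constant.\<close>
  have A: "(\<Sum>j<n. cnj (coeff (\<Lambda> j (p + 1)) 0) * poly (\<Phi> j) z) = poly (G p) z"
    if p: "p \<in> {1..r}" for p
  proof -
    have "pairing (r + 1) \<omega> (G p) (\<Lambda> j) = cnj (coeff (\<Lambda> j (p + 1)) 0)" if "j < n" for j
      unfolding pair [OF that] using p by (simp add: coeff_G \<mu>_G if_distrib cong: if_cong)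
    then show ?thesis
      using expand [of "G p" z] coeff_G by simp
  qed
  have B: "(\<Sum>j<n. cnj (coeff (\<Lambda> j 1) l) * poly (\<Phi> j) z) =
      z ^ l - (\<Sum>p=1..r. complex_of_real (a l) * x p ^ l * poly (G p) z)" if l: "l < n" for l
  proof -
    \<comment> \<open>All arc moments of the monomial are removed, while its coefficients below
      \<open>N\<close> are left untouched.\<close>
    define P where "P = monom 1 l - (\<Sum>p=1..r. smult (complex_of_real (a l) * x p ^ l) (G p))"
    have \<mu>_P: "\<mu> q P = 0" if q: "q \<in> {1..r}" for q
    proof -
      \<comment> \<open>The subtracted part is named so that additivity of \<open>\<mu> q\<close>
        applies to \<open>P + H\<close>.\<close>
      define H where "H = (\<Sum>p=1..r. smult (complex_of_real (a l) * x p ^ l) (G p))"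
      have "\<mu> q H = complex_of_real (a l) * x q ^ l"
        unfolding H_def \<mu>_sum [OF q] using q
        by (simp add: \<mu>_smult \<mu>_G if_distrib cong: if_cong)
      moreover have "monom 1 l = P + H"
        by (simp add: P_def H_def)
      then have "\<mu> q (monom 1 l) = \<mu> q P + \<mu> q H"
        by (simp only: \<mu>_def weight_form_add_left [OF w' [OF q]])
      ultimately show ?thesis
        by (simp add: \<mu>_monom [OF q])
    qed
    have coeff_P: "coeff P i = (if i = l then 1 else 0)" if "i < N \<or> n \<le> i" for i
      using coeff_G [OF that] by (auto simp: P_def coeff_sum)
    \<comment> \<open>If \<open>l < N\<close>, one coefficient survives; if
      \<open>N \<le> l\<close>, both sides are 0.\<close>
    have "pairing (r + 1) \<omega> P (\<Lambda> j) = cnj (coeff (\<Lambda> j 1) l)" if "j < n" for j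
      unfolding pair [OF that] using \<Lambda>1 [OF that, of l]
      by (cases "l < N") (simp_all add: \<mu>_P coeff_P mult_delta_left)
    moreover have "poly P z = z ^ l - (\<Sum>p=1..r. complex_of_real (a l) * x p ^ l * poly (G p) z)"
      by (simp add: P_def poly_sum poly_monom)
    ultimately show ?thesis
      using expand [of P z] coeff_P l by simp
  qed

  \<comment> \<open>Assembly of the kernel\<close>
  have cis_\<xi>: "cis (Arg2pi \<xi>) = \<xi>"
    using \<xi> complex_norm_eq_1_exp by (simp add: cis_conv_exp)
  \<comment> \<open>This is the range of angles on which the weights are prescribed.\<close>
  have arg: "Arg2pi \<xi> \<in> {0..<2*pi}"
    using Arg2pi_ge_0 Arg2pi_lt_2pi by auto
  have \<Psi>: "cnj (linear_form (r + 1) \<omega> (\<Lambda> j) \<xi>) =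
      (\<Sum>l<n. cnj (coeff (\<Lambda> j 1) l) * cnj \<xi> ^ l) +
      (\<Sum>p=1..r. cnj (coeff (\<Lambda> j (p + 1)) 0) * \<iota> p)" if j: "j < n" for j
  proof -
    \<comment> \<open>Padded with zero coefficients up to \<open>n\<close>, the range of the sums in
      the claim.\<close>
    have "poly (\<Lambda> j 1) \<xi> = (\<Sum>l<n. coeff (\<Lambda> j 1) l * \<xi> ^ l)"
      using \<Lambda>1 [OF j] N by (intro poly_eq_sum_lessThan) auto
    moreover have "poly (\<Lambda> j (p + 1)) \<xi> = coeff (\<Lambda> j (p + 1)) 0" if "p \<in> {1..r}" for p
      by (subst \<Lambda>p [OF j that]) simp
    moreover have "complex_of_real (\<omega> (p + 1) \<xi>) = \<iota> p" if "p \<in> {1..r}" for p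
      using \<omega>E [OF that arg] by (simp add: cis_\<xi> \<iota>_def indicator_def)
    moreover have "cnj (\<iota> p) = \<iota> p" for p
      by (simp add: \<iota>_def indicator_def)
    moreover have "\<omega> 1 \<xi> = 1"
      using bspec [OF \<omega>1 arg] by (simp add: cis_\<xi>)
    ultimately show ?thesis
      unfolding linear_form_def sum_from_1_split by simp
  qed
  have "CD_kernel (r + 1) \<omega> \<nu> z \<xi> = (\<Sum>j<n. poly (\<Phi> j) z * cnj (linear_form (r + 1) \<omega> (\<Lambda> j) \<xi>))"
    by (simp only: CD_kernel_def size \<Phi>_def \<Lambda>_def)
  also have "\<dots> = (\<Sum>j<n. (\<Sum>l<n. cnj \<xi> ^ l * (cnj (coeff (\<Lambda> j 1) l) * poly (\<Phi> j) z)) +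
      (\<Sum>p=1..r. \<iota> p * (cnj (coeff (\<Lambda> j (p + 1)) 0) * poly (\<Phi> j) z)))"
    by (intro sum.cong refl, subst \<Psi>) (auto simp: distrib_left sum_distrib_left mult_ac)
  \<comment> \<open>Exchanging sums collects the factor of each power of \<open>cnj \<xi>\<close>
    and of each \<open>\<iota> p\<close>; \<open>B\<close> and \<open>A\<close> evaluate these
    factors.\<close>
  also have "\<dots> = (\<Sum>l<n. cnj \<xi> ^ l * (\<Sum>j<n. cnj (coeff (\<Lambda> j 1) l) * poly (\<Phi> j) z)) +
      (\<Sum>p=1..r. \<iota> p * (\<Sum>j<n. cnj (coeff (\<Lambda> j (p + 1)) 0) * poly (\<Phi> j) z))"
    unfolding sum.distrib sum_distrib_left by (intro arg_cong2 [where f = "(+)"] sum.swap)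
  also have "\<dots> =
      (\<Sum>l<n. cnj \<xi> ^ l * (z ^ l - (\<Sum>p=1..r. complex_of_real (a l) * x p ^ l * poly (G p) z))) +
      (\<Sum>p=1..r. \<iota> p * poly (G p) z)"
    by (intro arg_cong2 [where f = "(+)"] arg_cong2 [where f = "(*)"] sum.cong refl A B) auto
  also have "\<dots> = (\<Sum>l<n. (z * cnj \<xi>) ^ l) +
      (\<Sum>p=1..r. (\<iota> p - (\<Sum>l<n. cnj \<xi> ^ l * complex_of_real (a l) * x p ^ l))
        * poly (G p) z)"
  proof -
    have "(\<Sum>l<n. \<Sum>p=1..r. cnj \<xi> ^ l * (complex_of_real (a l) * x p ^ l * poly (G p) z)) =
        (\<Sum>p=1..r. (\<Sum>l<n. cnj \<xi> ^ l * complex_of_real (a l) * x p ^ l) * poly (G p) z)"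
      by (subst sum.swap) (simp only: sum_distrib_right mult.assoc)
    moreover have "cnj \<xi> ^ l * z ^ l = (z * cnj \<xi>) ^ l" for l
      by (simp add: power_mult_distrib)
    ultimately show ?thesis
      by (simp only: right_diff_distrib left_diff_distrib sum_subtractf sum_distrib_left)
        (simp only: diff_add_eq add_diff_eq)
  qed
  finally have "CD_kernel (r + 1) \<omega> \<nu> z \<xi> - (\<Sum>j<n. (z * cnj \<xi>) ^ j) =
      (\<Sum>p=1..r. (\<iota> p - (\<Sum>l<n. cnj \<xi> ^ l * complex_of_real (a l) * x p ^ l))
        * poly (G p) z)"
    by simp
  moreover have "cnj \<xi> ^ l = \<xi> powi (- int l)" for l
  proof -
    have "\<xi> * cnj \<xi> = 1"
      using \<xi> complex_norm_square [of \<xi>] by simp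
    then have "cnj \<xi> = inverse \<xi>"
      by (rule inverse_unique [symmetric])
    then show ?thesis
      by (simp add: power_int_minus power_inverse)
  qed
  ultimately show ?thesis
    by (simp only: poly_G N_def \<iota>_def)
qed

end
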